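(* Let $\mathbb{K}$ be a field with $\operatorname{char}\mathbb{K}=0$. The Lie algebra $\operatorname{Vec}(\mathrm{SL}_2(\mathbb{K}))$ is generated, as a Lie algebra over $\mathbb{K}$, by the three vector fields $$V_{12},\quad a_{21}V_{21},\quad a_{22}V_{21},$$ where $V_{12} = a_{21}\frac{\partial}{\partial a_{11}} + a_{22}\frac{\partial}{\partial a_{12}}$ and $V_{21} = a_{11}\frac{\partial}{\partial a_{21}} + a_{12}\frac{\partial}{\partial a_{22}}$.
   Context: Coordinates on $2\times2$ matrices are $(a_{ij})_{i,j=1}^2$, and $\mathrm{SL}_2(\mathbb{K})$ is the affine variety $\{a_{11}a_{22}-a_{12}a_{21}=1\}$ with coordinate ring $\mathbb{K}[\mathrm{SL}_2]=\mathbb{K}[a_{11},a_{12},a_{21},a_{22}]/(a_{11}a_{22}-a_{12}a_{21}-1)$. $\operatorname{Vec}(\mathrm{SL}_2(\mathbb{K}))$ is the Lie algebra over $\mathbb{K}$ of polynomial vector fields on $\mathrm{SL}_2(\mathbb{K})$, i.e. the $\mathbb{K}$-linear derivations of this coordinate ring, with the commutator bracket. The vector fields $V_{12}$ and $V_{21}$ are tangent to $\mathrm{SL}_2(\mathbb{K})$ and hence define elements of $\operatorname{Vec}(\mathrm{SL}_2(\mathbb{K}))$. *)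

theory Defs
  imports Complex_Main "HOL-Library.Poly_Mapping" "HOL.Hull"
begin

datatype coord = A11 | A12 | A21 | A22

text \<open>Polynomials in the four matrix entries: finitely supported functions from exponent
  vectors to coefficients.\<close>

type_synonym 'k mpoly4 = "(coord \<Rightarrow>\<^sub>0 nat) \<Rightarrow>\<^sub>0 'k"

lemma mpoly4_induct [case_names single add]:
  fixes p :: "'k::field mpoly4"
  assumes single: "\<And>m c. P (Poly_Mapping.single m c)"
    and add: "\<And>p q. P p \<Longrightarrow> P q \<Longrightarrow> P (p + q)"
  shows "P p"
proof (induction p rule: update_induct)
  case const
  show ?case using single[of 0 0] by simp
next
  case (update f a b)
  have "Poly_Mapping.update a b f = f + Poly_Mapping.single a b"
    using update by (intro poly_mapping_eqI)
      (auto simp: lookup_update lookup_add lookup_single when_def in_keys_iff)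
  then show ?case using add[OF update(3) single] by simp
qed

definition Var :: "coord \<Rightarrow> 'k::field mpoly4"
  where "Var i = Poly_Mapping.single (Poly_Mapping.single i 1) 1"

definition Const :: "'k::field \<Rightarrow> 'k mpoly4"
  where "Const c = Poly_Mapping.single 0 c"

lemma Const_0: "Const 0 = 0"
  by (simp add: Const_def)

lemma Const_1: "Const 1 = 1"
  by (simp add: Const_def)

lemma Const_add: "Const (a + b) = Const a + Const b"
  by (simp add: Const_def single_add)

lemma Const_mult: "Const (a * b) = Const a * Const b"
  by (simp add: Const_def mult_single)

text \<open>The partial derivative with respect to the coordinate \<open>i\<close>: the coefficient of \<open>x\<^sup>m\<close> in it is
  \<open>m\<^sub>i + 1\<close> times the coefficient of \<open>x\<^sup>m x\<^sub>i\<close> in the given polynomial.\<close>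

lift_definition pdiff :: "coord \<Rightarrow> 'k::field mpoly4 \<Rightarrow> 'k mpoly4"
  is "\<lambda>i p m. of_nat (Poly_Mapping.lookup m i + 1) * p (m + Poly_Mapping.single i 1)"
proof -
  fix i :: coord and p :: "(coord \<Rightarrow>\<^sub>0 nat) \<Rightarrow> 'k"
  assume fin: "finite {m. p m \<noteq> 0}"
  have "finite ((\<lambda>m. m + Poly_Mapping.single i 1) -` {m. p m \<noteq> 0})"
    by (rule finite_vimageI[OF fin]) (simp add: inj_on_def)
  then show "finite {m. of_nat (Poly_Mapping.lookup m i + 1) * p (m + Poly_Mapping.single i 1) \<noteq> 0}"
    by (rule rev_finite_subset) auto
qed

lemma pdiff_add: "pdiff i (p + q) = pdiff i p + pdiff i q"
  by (rule poly_mapping_eqI) (simp add: pdiff.rep_eq lookup_add algebra_simps)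

lemma pdiff_diff: "pdiff i (p - q) = pdiff i p - pdiff i q"
  by (rule poly_mapping_eqI) (simp add: pdiff.rep_eq lookup_minus algebra_simps)

lemma pdiff_0: "pdiff i 0 = 0"
  by (rule poly_mapping_eqI) (simp add: pdiff.rep_eq)

lemma pdiff_single:
  "pdiff i (Poly_Mapping.single m c) =
    Poly_Mapping.single (m - Poly_Mapping.single i 1) (of_nat (Poly_Mapping.lookup m i) * c)"
proof (rule poly_mapping_eqI)
  fix n
  show "Poly_Mapping.lookup (pdiff i (Poly_Mapping.single m c)) n =
    Poly_Mapping.lookup (Poly_Mapping.single (m - Poly_Mapping.single i 1)
      (of_nat (Poly_Mapping.lookup m i) * c)) n"
  proof (cases "Poly_Mapping.lookup m i = 0")
    case True
    then have "m \<noteq> n + Poly_Mapping.single i 1"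
      by (auto simp: lookup_add)
    then show ?thesis
      using True by (simp add: pdiff.rep_eq lookup_single)
  next
    case False
    have eq: "m = n + Poly_Mapping.single i 1 \<longleftrightarrow> m - Poly_Mapping.single i 1 = n"
    proof
      assume "m - Poly_Mapping.single i 1 = n"
      moreover have "m = (m - Poly_Mapping.single i 1) + Poly_Mapping.single i 1"
        using False
        by (intro poly_mapping_eqI) (auto simp: lookup_add lookup_minus lookup_single when_def)
      ultimately show "m = n + Poly_Mapping.single i 1" by simp
    qed simp
    show ?thesis
    proof (cases "m = n + Poly_Mapping.single i 1")
      case True
      then show ?thesis by (simp add: pdiff.rep_eq lookup_add)
    next
      case False
      then show ?thesis using eq
        by (simp add: pdiff.rep_eq lookup_single when_def)
    qed
  qed
qed

lemma pdiff_Const: "pdiff i (Const c) = 0"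
  by (simp add: Const_def pdiff_single)

lemma pdiff_1: "pdiff i 1 = 0"
  by (metis Const_1 pdiff_Const)

lemma pdiff_Var: "pdiff i (Var j) = (if i = j then 1 else 0)"
  by (auto simp: Var_def pdiff_single lookup_single)

lemma single_shift:
  fixes m n :: "coord \<Rightarrow>\<^sub>0 nat" and c :: "'k::field"
  shows "Poly_Mapping.single (m + n - Poly_Mapping.single i 1) (of_nat (Poly_Mapping.lookup m i) * c) =
    Poly_Mapping.single ((m - Poly_Mapping.single i 1) + n) (of_nat (Poly_Mapping.lookup m i) * c)"
proof (cases "Poly_Mapping.lookup m i = 0")
  case False
  then have "m + n - Poly_Mapping.single i 1 = (m - Poly_Mapping.single i 1) + n"
    by (intro poly_mapping_eqI) (auto simp: lookup_add lookup_minus lookup_single when_def)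
  then show ?thesis by simp
qed simp

lemma pdiff_mult: "pdiff i (p * q) = pdiff i p * q + p * pdiff i q"
proof (induction p rule: mpoly4_induct)
  case (single m c)
  show ?case
  proof (induction q rule: mpoly4_induct)
    case (single n d)
    show ?case
      using single_shift[of m n i "c * d"] single_shift[of n m i "c * d"]
      by (simp add: mult_single pdiff_single single_add lookup_add algebra_simps)
  qed (simp add: pdiff_add algebra_simps)
qed (simp add: pdiff_add algebra_simps)

definition det_rel :: "'k::field mpoly4"
  where "det_rel = Var A11 * Var A22 - Var A12 * Var A21 - 1"

lemma pdiff_det_rel:
  "pdiff A11 det_rel = Var A22" "pdiff A12 det_rel = - Var A21"
  "pdiff A21 det_rel = - Var A12" "pdiff A22 det_rel = Var A11"
  by (simp_all add: det_rel_def pdiff_diff pdiff_mult pdiff_Var pdiff_1)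

definition mp_eval :: "(coord \<Rightarrow> 'k) \<Rightarrow> 'k::field mpoly4 \<Rightarrow> 'k"
  where "mp_eval x p = (\<Sum>m\<in>Poly_Mapping.keys p. Poly_Mapping.lookup p m *
    (x A11 ^ Poly_Mapping.lookup m A11 * x A12 ^ Poly_Mapping.lookup m A12 *
     x A21 ^ Poly_Mapping.lookup m A21 * x A22 ^ Poly_Mapping.lookup m A22))"

lemma mp_eval_add: "mp_eval x (p + q) = mp_eval x p + mp_eval x q"
  unfolding mp_eval_def
  by (rule setsum_keys_plus_distrib) (simp_all add: algebra_simps)

lemma mp_eval_single:
  "mp_eval x (Poly_Mapping.single m c) = c *
    (x A11 ^ Poly_Mapping.lookup m A11 * x A12 ^ Poly_Mapping.lookup m A12 *
     x A21 ^ Poly_Mapping.lookup m A21 * x A22 ^ Poly_Mapping.lookup m A22)"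
  by (simp add: mp_eval_def)

lemma mp_eval_mult: "mp_eval x (p * q) = mp_eval x p * mp_eval x q"
proof (induction p rule: mpoly4_induct)
  case (single m c)
  show ?case
  proof (induction q rule: mpoly4_induct)
    case (single n d)
    show ?case
      by (simp add: mult_single mp_eval_single lookup_add power_add)
  qed (simp add: mp_eval_add algebra_simps)
qed (simp add: mp_eval_add algebra_simps)

lemma mp_eval_Var: "mp_eval x (Var i) = x i"
  by (cases i) (simp_all add: Var_def mp_eval_single lookup_single)

lemma mp_eval_Const: "mp_eval x (Const c) = c"
  by (simp add: Const_def mp_eval_single)

lemma mp_eval_diff: "mp_eval x (p - q) = mp_eval x p - mp_eval x q"
  using mp_eval_add[of x "p - q" q] by simp

lemma mp_eval_1: "mp_eval x 1 = 1"
  by (metis Const_1 mp_eval_Const)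

lemma det_rel_not_dvd_1: "\<not> det_rel dvd (1 :: 'k::field mpoly4)"
proof
  assume "det_rel dvd (1 :: 'k mpoly4)"
  then obtain r :: "'k mpoly4" where r: "1 = det_rel * r" ..
  define x :: "coord \<Rightarrow> 'k" where "x i = (if i = A11 \<or> i = A22 then 1 else 0)" for i
  have "mp_eval x det_rel = 0"
    by (simp add: det_rel_def mp_eval_diff mp_eval_mult mp_eval_Var mp_eval_1 x_def)
  then show False
    using arg_cong[OF r, of "mp_eval x"] by (simp add: mp_eval_mult mp_eval_1)
qed

text \<open>The coordinate ring of \<open>SL\<^sub>2\<close>: residue classes modulo the principal ideal generated by
  \<open>a\<^sub>1\<^sub>1 a\<^sub>2\<^sub>2 - a\<^sub>1\<^sub>2 a\<^sub>2\<^sub>1 - 1\<close>.\<close>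

quotient_type (overloaded) 'k sl2_ring = "'k::field mpoly4" / "\<lambda>p q. det_rel dvd p - q"
  morphisms rep_sl2 residue
proof (rule equivpI)
  show "reflp (\<lambda>p q :: 'k mpoly4. det_rel dvd p - q)"
    by (simp add: reflp_def)
  show "symp (\<lambda>p q :: 'k mpoly4. det_rel dvd p - q)"
    by (intro sympI) (metis dvd_minus_iff minus_diff_eq)
  show "transp (\<lambda>p q :: 'k mpoly4. det_rel dvd p - q)"
  proof (rule transpI)
    fix p q r :: "'k mpoly4"
    assume "det_rel dvd p - q" "det_rel dvd q - r"
    then have "det_rel dvd (p - q) + (q - r)" by (rule dvd_add)
    then show "det_rel dvd p - r" by simp
  qed
qed

instantiation sl2_ring :: (field) comm_ring_1
begin

lift_definition zero_sl2_ring :: "'a sl2_ring" is 0 .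

lift_definition one_sl2_ring :: "'a sl2_ring" is 1 .

lift_definition plus_sl2_ring :: "'a sl2_ring \<Rightarrow> 'a sl2_ring \<Rightarrow> 'a sl2_ring" is "(+)"
  by (metis add_diff_add dvd_add)

lift_definition uminus_sl2_ring :: "'a sl2_ring \<Rightarrow> 'a sl2_ring" is uminus
  by (metis dvd_minus_iff minus_diff_eq minus_diff_minus)

lift_definition minus_sl2_ring :: "'a sl2_ring \<Rightarrow> 'a sl2_ring \<Rightarrow> 'a sl2_ring" is "(-)"
proof -
  fix p p' q q' :: "'a mpoly4"
  assume "det_rel dvd p - p'" "det_rel dvd q - q'"
  then have "det_rel dvd (p - p') - (q - q')" by (rule dvd_diff)
  then show "det_rel dvd (p - q) - (p' - q')" by (simp add: algebra_simps)
qed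

lift_definition times_sl2_ring :: "'a sl2_ring \<Rightarrow> 'a sl2_ring \<Rightarrow> 'a sl2_ring" is "(*)"
proof -
  fix p p' q q' :: "'a mpoly4"
  assume "det_rel dvd p - p'" "det_rel dvd q - q'"
  then have "det_rel dvd (p - p') * q + p' * (q - q')" by simp
  then show "det_rel dvd p * q - p' * q'" by (simp add: algebra_simps)
qed

instance
proof
  show "(0 :: 'a sl2_ring) \<noteq> 1"
    by transfer (use det_rel_not_dvd_1 in simp)
qed (transfer; simp add: algebra_simps)+

end

definition coord_fun :: "coord \<Rightarrow> 'k::field sl2_ring"
  where "coord_fun i = residue (Var i)"

definition scaleK :: "'k::field \<Rightarrow> 'k sl2_ring \<Rightarrow> 'k sl2_ring"
  where "scaleK c f = residue (Const c) * f"

lemma vector_space_scaleK: "vector_space (scaleK :: 'k::field \<Rightarrow> _)"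
proof
  fix a b :: 'k and f g :: "'k sl2_ring"
  show "scaleK a (f + g) = scaleK a f + scaleK a g"
    by (simp add: scaleK_def algebra_simps)
  show "scaleK (a + b) f = scaleK a f + scaleK b f"
    by (simp add: scaleK_def Const_add plus_sl2_ring.abs_eq[symmetric] algebra_simps)
  show "scaleK a (scaleK b f) = scaleK (a * b) f"
    by (simp add: scaleK_def Const_mult times_sl2_ring.abs_eq[symmetric] algebra_simps)
  show "scaleK 1 f = f"
    by (simp add: scaleK_def Const_1 one_sl2_ring.abs_eq[symmetric])
qed

lemma scaleK_simps:
  "scaleK c f * g = scaleK c (f * g)" "f * scaleK c g = scaleK c (f * g)"
  "scaleK c (f + g) = scaleK c f + scaleK c g" "scaleK c (f - g) = scaleK c f - scaleK c g"
  "scaleK c 0 = 0" "scaleK c (scaleK d f) = scaleK d (scaleK c f)"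
  by (simp_all add: scaleK_def algebra_simps)

text \<open>A polynomial vector field on \<open>SL\<^sub>2\<close> is a linear derivation of its coordinate ring.\<close>

definition Vec_SL2 :: "('k::field sl2_ring \<Rightarrow> 'k sl2_ring) set"
  where "Vec_SL2 = {D. Vector_Spaces.linear scaleK scaleK D \<and>
    (\<forall>f g. D (f * g) = D f * g + f * D g)}"

definition vf_mult :: "'k::field sl2_ring \<Rightarrow> ('k sl2_ring \<Rightarrow> 'k sl2_ring) \<Rightarrow> 'k sl2_ring \<Rightarrow> 'k sl2_ring"
  where "vf_mult h D = (\<lambda>f. h * D f)"

definition vf_bracket ::
    "('k::field sl2_ring \<Rightarrow> 'k sl2_ring) \<Rightarrow> ('k sl2_ring \<Rightarrow> 'k sl2_ring) \<Rightarrow> 'k sl2_ring \<Rightarrow> 'k sl2_ring"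
  where "vf_bracket D E = (\<lambda>f. D (E f) - E (D f))"

definition lie_subalgebra :: "('k::field sl2_ring \<Rightarrow> 'k sl2_ring) set \<Rightarrow> bool"
  where "lie_subalgebra L \<longleftrightarrow> L \<subseteq> Vec_SL2 \<and>
    (\<lambda>_. 0) \<in> L \<and>
    (\<forall>D\<in>L. \<forall>E\<in>L. (\<lambda>f. D f + E f) \<in> L) \<and>
    (\<forall>c. \<forall>D\<in>L. (\<lambda>f. scaleK c (D f)) \<in> L) \<and>
    (\<forall>D\<in>L. \<forall>E\<in>L. vf_bracket D E \<in> L)"

text \<open>Lie subalgebras are taken inside \<open>Vec_SL2\<close>, because the commutator is not bilinear on arbitrary
  functions. \<open>Vec_SL2\<close> is one itself (\<open>lie_subalgebra_Vec\<close>), so for generators in \<open>Vec_SL2\<close> the hull is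
  an intersection over a nonempty family.\<close>

definition lie_generated ::
    "('k::field sl2_ring \<Rightarrow> 'k sl2_ring) set \<Rightarrow> ('k sl2_ring \<Rightarrow> 'k sl2_ring) set"
  where "lie_generated S = lie_subalgebra hull S"

definition V12_poly :: "'k::field mpoly4 \<Rightarrow> 'k mpoly4"
  where "V12_poly p = Var A21 * pdiff A11 p + Var A22 * pdiff A12 p"

definition V21_poly :: "'k::field mpoly4 \<Rightarrow> 'k mpoly4"
  where "V21_poly p = Var A11 * pdiff A21 p + Var A12 * pdiff A22 p"

lemma V12_poly_mult: "V12_poly (p * q) = V12_poly p * q + p * V12_poly q"
  by (simp add: V12_poly_def pdiff_mult algebra_simps)

lemma V21_poly_mult: "V21_poly (p * q) = V21_poly p * q + p * V21_poly q"
  by (simp add: V21_poly_def pdiff_mult algebra_simps)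

text \<open>Tangency to \<open>SL\<^sub>2\<close>: both fields annihilate the defining equation, hence preserve the ideal and
  descend to the coordinate ring.\<close>

lemma V12_poly_det_rel: "V12_poly det_rel = 0"
  by (simp add: V12_poly_def pdiff_det_rel)

lemma V21_poly_det_rel: "V21_poly det_rel = 0"
  by (simp add: V21_poly_def pdiff_det_rel)

lift_definition V12 :: "'k::field sl2_ring \<Rightarrow> 'k sl2_ring" is V12_poly
proof -
  fix p q :: "'k mpoly4"
  assume "det_rel dvd p - q"
  then obtain r where "p - q = det_rel * r" ..
  then have "V12_poly (p - q) = det_rel * V12_poly r"
    by (simp add: V12_poly_mult V12_poly_det_rel)
  moreover have "V12_poly (p - q) = V12_poly p - V12_poly q"
    by (simp add: V12_poly_def pdiff_diff algebra_simps)
  ultimately show "det_rel dvd V12_poly p - V12_poly q" by simp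
qed

lift_definition V21 :: "'k::field sl2_ring \<Rightarrow> 'k sl2_ring" is V21_poly
proof -
  fix p q :: "'k mpoly4"
  assume "det_rel dvd p - q"
  then obtain r where "p - q = det_rel * r" ..
  then have "V21_poly (p - q) = det_rel * V21_poly r"
    by (simp add: V21_poly_mult V21_poly_det_rel)
  moreover have "V21_poly (p - q) = V21_poly p - V21_poly q"
    by (simp add: V21_poly_def pdiff_diff algebra_simps)
  ultimately show "det_rel dvd V21_poly p - V21_poly q" by simp
qed

lemma linear_scaleK_iff:
  "Vector_Spaces.linear scaleK scaleK D \<longleftrightarrow>
    (\<forall>f g. D (f + g) = D f + D g) \<and> (\<forall>c f. D (scaleK c f) = scaleK c (D f))"
  by (auto simp: Vector_Spaces.linear_iff vector_space_scaleK)

lemma V12_in_Vec: "V12 \<in> Vec_SL2"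
proof -
  have add: "V12 (f + g) = V12 f + V12 g" for f g :: "'a sl2_ring"
    by transfer (simp add: V12_poly_def pdiff_add algebra_simps)
  have mult: "V12 (f * g) = V12 f * g + f * V12 g" for f g :: "'a sl2_ring"
    by transfer (simp add: V12_poly_mult)
  have const: "V12 (residue (Const c)) = 0" for c :: 'a
    by (simp add: V12.abs_eq V12_poly_def pdiff_Const zero_sl2_ring_def)
  show ?thesis
    by (simp add: Vec_SL2_def linear_scaleK_iff add mult const scaleK_def)
qed

lemma V21_in_Vec: "V21 \<in> Vec_SL2"
proof -
  have add: "V21 (f + g) = V21 f + V21 g" for f g :: "'a sl2_ring"
    by transfer (simp add: V21_poly_def pdiff_add algebra_simps)
  have mult: "V21 (f * g) = V21 f * g + f * V21 g" for f g :: "'a sl2_ring"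
    by transfer (simp add: V21_poly_mult)
  have const: "V21 (residue (Const c)) = 0" for c :: 'a
    by (simp add: V21.abs_eq V21_poly_def pdiff_Const zero_sl2_ring_def)
  show ?thesis
    by (simp add: Vec_SL2_def linear_scaleK_iff add mult const scaleK_def)
qed

lemma vf_mult_in_Vec: "D \<in> Vec_SL2 \<Longrightarrow> vf_mult h D \<in> Vec_SL2"
  by (auto simp: Vec_SL2_def linear_scaleK_iff vf_mult_def scaleK_def algebra_simps)

lemma lie_subalgebra_Vec: "lie_subalgebra (Vec_SL2 :: ('k::field sl2_ring \<Rightarrow> 'k sl2_ring) set)"
proof -
  have diff: "D (f - g) = D f - D g"
    if "\<forall>f g. D (f + g) = D f + D g" for D :: "'k sl2_ring \<Rightarrow> 'k sl2_ring" and f g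
    using that[rule_format, of "f - g" g] by simp
  show ?thesis
    unfolding lie_subalgebra_def
  proof (intro conjI ballI allI)
    fix D E :: "'k sl2_ring \<Rightarrow> 'k sl2_ring" and c :: 'k
    assume D: "D \<in> Vec_SL2"
    show "(\<lambda>f. scaleK c (D f)) \<in> Vec_SL2"
      using D by (auto simp: Vec_SL2_def linear_scaleK_iff scaleK_simps)
    assume E: "E \<in> Vec_SL2"
    show "(\<lambda>f. D f + E f) \<in> Vec_SL2"
      using D E by (auto simp: Vec_SL2_def linear_scaleK_iff scaleK_simps algebra_simps)
    show "vf_bracket D E \<in> Vec_SL2"
      using D E
      by (auto simp: Vec_SL2_def linear_scaleK_iff vf_bracket_def scaleK_simps diff algebra_simps)
  qed (auto simp: Vec_SL2_def linear_scaleK_iff scaleK_simps)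
qed

lemma lie_subalgebra_generated:
  assumes "S \<subseteq> Vec_SL2"
  shows "lie_subalgebra (lie_generated S)"
proof -
  have "lie_generated S \<subseteq> Vec_SL2"
    unfolding lie_generated_def using assms lie_subalgebra_Vec by (rule hull_minimal)
  then show ?thesis
    unfolding lie_subalgebra_def[of "lie_generated S"]
    by (auto simp: lie_generated_def hull_def lie_subalgebra_def)
qed

end

theory Submission
  imports Defs
begin

text \<open>Write \<open>E = V12\<close>, \<open>F = V21\<close> and \<open>H = [E, F]\<close>. These satisfy the relations of \<open>sl\<^sub>2\<close>, and by
  Cramer's rule with determinant \<open>1\<close> they span the vector fields over the coordinate ring. Let \<open>L\<close> be
  the generated Lie algebra. First, \<open>[a\<^sub>2\<^sub>1 F, a\<^sub>2\<^sub>2 F] = - F\<close>, so \<open>E\<close>, \<open>F\<close>, \<open>H\<close> lie in \<open>L\<close>, and then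
  so do their products with the coordinates. If \<open>fE\<close>, \<open>fF\<close>, \<open>fH\<close> lie in \<open>L\<close> for an eigenfunction
  \<open>f\<close> of \<open>H\<close>, then brackets with coordinate multiples of \<open>E\<close>, \<open>F\<close>, \<open>H\<close> give the same for \<open>f\<close> times
  a coordinate, where each bracket fails for at most one eigenvalue and another one takes its place.
  Since monomials are eigenfunctions of \<open>H\<close>, this reaches the whole coordinate ring.\<close>

section \<open>Monomials in the coordinate ring\<close>

text \<open>Each step raises one exponent by one, which in the coordinate ring is multiplication by
  a single coordinate.\<close>

lemma exponent_induct [case_names zero step]:
  fixes m :: "'a \<Rightarrow>\<^sub>0 nat"
  assumes zero: "P 0"
    and step: "\<And>m i. P m \<Longrightarrow> P (Poly_Mapping.single i 1 + m)"
  shows "P m"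
proof (induction m rule: update_induct)
  case (update f a b)
  have "P (Poly_Mapping.single a b + f)" for b
  proof (induction b)
    case (Suc b)
    have "Poly_Mapping.single a (Suc b) = Poly_Mapping.single a 1 + Poly_Mapping.single a b"
      by (simp add: single_add[symmetric])
    then show ?case
      using step[OF Suc, of a] by (simp add: add.assoc)
  qed (use update in simp)
  moreover have "Poly_Mapping.update a b f = Poly_Mapping.single a b + f"
    using update by (intro poly_mapping_eqI)
      (auto simp: lookup_update lookup_add lookup_single when_def in_keys_iff)
  ultimately show ?case by simp
qed (rule zero)

inductive sl2_monomial :: "'k::field sl2_ring \<Rightarrow> bool" where
  const: "sl2_monomial (residue (Const c))"
| coord: "sl2_monomial f \<Longrightarrow> sl2_monomial (coord_fun i * f)"

lemma sl2_monomial_residue_single: "sl2_monomial (residue (Poly_Mapping.single m c))"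
proof (induction m rule: exponent_induct)
  case zero
  show ?case
    using sl2_monomial.const[of c] by (simp add: Const_def)
next
  case (step m i)
  have "residue (Poly_Mapping.single (Poly_Mapping.single i 1 + m) c) =
      coord_fun i * residue (Poly_Mapping.single m c)"
    by (simp add: coord_fun_def times_sl2_ring.abs_eq Var_def mult_single)
  then show ?case
    using sl2_monomial.coord[OF step, of i] by simp
qed

lemma sl2_ring_induct [case_names monomial add]:
  assumes monomial: "\<And>f. sl2_monomial f \<Longrightarrow> P f"
    and add: "\<And>f g. P f \<Longrightarrow> P g \<Longrightarrow> P (f + g)"
  shows "P f"
proof (induction f rule: sl2_ring.abs_induct)
  case (1 p)
  show ?case
  proof (induction p rule: mpoly4_induct)
    case (single m c)
    show ?case by (intro monomial sl2_monomial_residue_single)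
  next
    case (add p q)
    then show ?case using assms(2) by (simp add: plus_sl2_ring.abs_eq[symmetric])
  qed
qed

lemma residue_Const_of_nat: "residue (Const (of_nat n)) = of_nat n"
  by (induction n)
    (simp_all add: Const_0 Const_1 Const_add zero_sl2_ring_def one_sl2_ring_def plus_sl2_ring.abs_eq[symmetric])

lemma residue_Const_of_int: "residue (Const (of_int k)) = of_int k"
proof -
  have minus: "residue (Const (- c)) = - residue (Const c)" for c :: 'a
    by (simp add: uminus_sl2_ring.abs_eq Const_def single_uminus)
  show ?thesis
    by (cases k rule: int_cases2) (simp_all add: residue_Const_of_nat minus)
qed

lemma scaleK_of_int: "scaleK (of_int k) f = of_int k * f"
  by (simp add: scaleK_def residue_Const_of_int)

text \<open>Characteristic zero enters here: a nonzero integer stays nonzero in \<open>'k\<close>,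
  so integer factors produced by brackets can be cancelled.\<close>

lemma scaleK_inverse_of_int:
  fixes f :: "'k::field_char_0 sl2_ring"
  assumes "k \<noteq> 0"
  shows "scaleK (inverse (of_int k)) (of_int k * f) = f"
proof -
  interpret vector_space "scaleK :: 'k \<Rightarrow> _" by (rule vector_space_scaleK)
  show ?thesis using assms by (simp flip: scaleK_of_int)
qed

lemma coord_fun_det:
  "coord_fun A11 * coord_fun A22 - coord_fun A12 * coord_fun A21 = 1"
  by (simp add: coord_fun_def times_sl2_ring.abs_eq minus_sl2_ring.abs_eq one_sl2_ring_def
      sl2_ring.abs_eq_iff det_rel_def)

section \<open>Vector fields as combinations of a frame\<close>

lemma Vec_SL2_add: "D \<in> Vec_SL2 \<Longrightarrow> D (f + g) = D f + D g"
  and Vec_SL2_mult: "D \<in> Vec_SL2 \<Longrightarrow> D (f * g) = D f * g + f * D g"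
  and Vec_SL2_scaleK: "D \<in> Vec_SL2 \<Longrightarrow> D (scaleK c f) = scaleK c (D f)"
  by (auto simp: Vec_SL2_def linear_scaleK_iff)

lemma Vec_SL2_diff: "D \<in> Vec_SL2 \<Longrightarrow> D (f - g) = D f - D g"
  using Vec_SL2_add[of D "f - g" g] by simp

lemma Vec_SL2_0: "D \<in> Vec_SL2 \<Longrightarrow> D 0 = 0"
  using Vec_SL2_diff[of D 0 0] by simp

lemma Vec_SL2_minus: "D \<in> Vec_SL2 \<Longrightarrow> D (- f) = - D f"
  using Vec_SL2_diff[of D 0 f] by (simp add: Vec_SL2_0)

lemma Vec_SL2_1: "D \<in> Vec_SL2 \<Longrightarrow> D 1 = 0"
  using Vec_SL2_mult[of D 1 1] by simp

lemma Vec_SL2_of_int_mult: "D \<in> Vec_SL2 \<Longrightarrow> D (of_int k * f) = of_int k * D f"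
  by (simp add: Vec_SL2_scaleK flip: scaleK_of_int)

lemma Vec_SL2_Const: "D \<in> Vec_SL2 \<Longrightarrow> D (residue (Const c)) = 0"
  using Vec_SL2_scaleK[of D c 1] by (simp add: scaleK_def Vec_SL2_1)

text \<open>Derivations kill constants and obey the Leibniz rule, so their values on the coordinates
  fix them on monomials. Identities between fields thus reduce to four checks.\<close>

lemma Vec_SL2_eqI:
  assumes "D \<in> Vec_SL2" "D' \<in> Vec_SL2" and eq: "\<And>i. D (coord_fun i) = D' (coord_fun i)"
  shows "D = D'"
proof
  fix f
  show "D f = D' f"
  proof (induction f rule: sl2_ring_induct)
    case (monomial f)
    then show ?case
      by induction (simp_all add: assms Vec_SL2_Const Vec_SL2_mult)
  qed (simp add: assms Vec_SL2_add)
qed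

section \<open>The frame \<open>V12\<close>, \<open>V21\<close>, \<open>V0\<close> and its
  commutation relations\<close>

definition V0 :: "'k::field sl2_ring \<Rightarrow> 'k sl2_ring"
  where "V0 = vf_bracket V12 V21"

lemma V0_in_Vec: "V0 \<in> Vec_SL2"
  using lie_subalgebra_Vec V12_in_Vec V21_in_Vec by (auto simp: V0_def lie_subalgebra_def)

lemmas frame_in_Vec = V12_in_Vec V21_in_Vec V0_in_Vec

lemma V12_coord_fun:
  "V12 (coord_fun A11) = coord_fun A21" "V12 (coord_fun A12) = coord_fun A22"
  "V12 (coord_fun A21) = 0" "V12 (coord_fun A22) = 0"
  by (simp_all add: coord_fun_def V12.abs_eq V12_poly_def pdiff_Var zero_sl2_ring_def)

lemma V21_coord_fun:
  "V21 (coord_fun A11) = 0" "V21 (coord_fun A12) = 0"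
  "V21 (coord_fun A21) = coord_fun A11" "V21 (coord_fun A22) = coord_fun A12"
  by (simp_all add: coord_fun_def V21.abs_eq V21_poly_def pdiff_Var zero_sl2_ring_def)

lemma V0_coord_fun:
  "V0 (coord_fun A11) = - coord_fun A11" "V0 (coord_fun A12) = - coord_fun A12"
  "V0 (coord_fun A21) = coord_fun A21" "V0 (coord_fun A22) = coord_fun A22"
  by (simp_all add: V0_def vf_bracket_def V12_coord_fun V21_coord_fun frame_in_Vec Vec_SL2_0)

lemmas frame_coord_fun = V12_coord_fun V21_coord_fun V0_coord_fun

definition frame_field ::
    "'k::field sl2_ring \<Rightarrow> 'k sl2_ring \<Rightarrow> 'k sl2_ring \<Rightarrow> 'k sl2_ring \<Rightarrow> 'k sl2_ring"
  where "frame_field u v w = (\<lambda>f. u * V12 f + v * V21 f + w * V0 f)"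

lemma frame_field_in_Vec: "frame_field u v w \<in> Vec_SL2"
  unfolding Vec_SL2_def linear_scaleK_iff frame_field_def
  by (simp add: frame_in_Vec Vec_SL2_add Vec_SL2_mult Vec_SL2_scaleK scaleK_simps algebra_simps)

text \<open>Together with \<open>V0_V12\<close> and \<open>V0_V21\<close> this rewrites compositions
  into a fixed order: \<open>V21\<close> outermost, then \<open>V12\<close>, with \<open>V0\<close>
  innermost.\<close>

lemma V12_V21: "V12 (V21 f) = V21 (V12 f) + V0 f"
  by (simp add: V0_def vf_bracket_def)

lemma V0_V12: "V0 (V12 f) = V12 (V0 f) + 2 * V12 f"
proof -
  have "vf_bracket V0 V12 = frame_field 2 0 (0 :: 'a sl2_ring)"
  proof (rule Vec_SL2_eqI)
    show "vf_bracket V0 V12 \<in> (Vec_SL2 :: ('a sl2_ring \<Rightarrow> _) set)"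
      using lie_subalgebra_Vec frame_in_Vec by (auto simp: lie_subalgebra_def)
    show "vf_bracket V0 V12 (coord_fun i) = frame_field 2 0 (0 :: 'a sl2_ring) (coord_fun i)" for i
      by (cases i) (simp_all add: vf_bracket_def frame_field_def frame_coord_fun frame_in_Vec
          Vec_SL2_0 Vec_SL2_minus)
  qed (rule frame_field_in_Vec)
  then show ?thesis
    by (simp add: vf_bracket_def frame_field_def fun_eq_iff algebra_simps)
qed

lemma V0_V21: "V0 (V21 f) = V21 (V0 f) - 2 * V21 f"
proof -
  have "vf_bracket V0 V21 = frame_field 0 (- 2) (0 :: 'a sl2_ring)"
  proof (rule Vec_SL2_eqI)
    show "vf_bracket V0 V21 \<in> (Vec_SL2 :: ('a sl2_ring \<Rightarrow> _) set)"
      using lie_subalgebra_Vec frame_in_Vec by (auto simp: lie_subalgebra_def)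
    show "vf_bracket V0 V21 (coord_fun i) = frame_field 0 (- 2) (0 :: 'a sl2_ring) (coord_fun i)" for i
      by (cases i) (simp_all add: vf_bracket_def frame_field_def frame_coord_fun frame_in_Vec
          Vec_SL2_0 Vec_SL2_minus)
  qed (rule frame_field_in_Vec)
  then show ?thesis
    by (simp add: vf_bracket_def frame_field_def fun_eq_iff algebra_simps)
qed

text \<open>The Leibniz rule gives the derivatives of the coefficients; second-order terms cancel up
  to \<open>[E, F] = H\<close>, \<open>[H, E] = 2E\<close>, \<open>[H, F] = -2F\<close>, which give
  the remaining products.\<close>

lemma vf_bracket_frame_field:
  "vf_bracket (frame_field u v w) (frame_field u' v' w') =
    frame_field
      (frame_field u v w u' - frame_field u' v' w' u + 2 * (w * u' - u * w'))
      (frame_field u v w v' - frame_field u' v' w' v - 2 * (w * v' - v * w'))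
      (frame_field u v w w' - frame_field u' v' w' w + (u * v' - v * u'))"
  unfolding vf_bracket_def frame_field_def fun_eq_iff
  by (simp add: frame_in_Vec Vec_SL2_add Vec_SL2_mult V12_V21 V0_V12 V0_V21 algebra_simps)

lemma Vec_SL2_eq_frame_field:
  fixes D :: "'k::field sl2_ring \<Rightarrow> 'k sl2_ring"
  assumes D: "D \<in> Vec_SL2"
  obtains u v w where "D = frame_field u v w"
proof
  let ?a = "coord_fun A11 :: 'k sl2_ring" and ?b = "coord_fun A12 :: 'k sl2_ring"
  let ?c = "coord_fun A21 :: 'k sl2_ring" and ?d = "coord_fun A22 :: 'k sl2_ring"
  have det: "?a * ?d = 1 + ?b * ?c"
    using coord_fun_det[where 'a='k] by (simp add: algebra_simps)
  have tangent: "D ?a * ?d + ?a * D ?d = D ?b * ?c + ?b * D ?c"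
    using arg_cong[OF det, of D] by (simp add: D Vec_SL2_add Vec_SL2_mult Vec_SL2_1)
  \<comment> \<open>The top row of the matrix gives a linear system for \<open>u\<close> and
    \<open>w\<close>, the bottom row one for \<open>v\<close> and \<open>w\<close>. Tangency makes
    their two Cramer solutions for \<open>w\<close> agree.\<close>
  have w: "?c * D ?b - ?d * D ?a = ?a * D ?d - ?b * D ?c"
    using tangent by (simp add: algebra_simps)
  \<comment> \<open>Inserting the determinant as a factor 1 turns each coordinate check into a
    polynomial identity.\<close>
  have times_det: "f = f * (?a * ?d) - f * (?b * ?c)" for f
    by (simp add: det algebra_simps)
  show "D = frame_field (?a * D ?b - ?b * D ?a) (?d * D ?c - ?c * D ?d) (?c * D ?b - ?d * D ?a)"
  proof (rule Vec_SL2_eqI[OF D frame_field_in_Vec])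
    fix i
    show "D (coord_fun i) = frame_field (?a * D ?b - ?b * D ?a) (?d * D ?c - ?c * D ?d)
      (?c * D ?b - ?d * D ?a) (coord_fun i)"
    proof (cases i)
      case A11
      show ?thesis
        unfolding A11 by (subst times_det) (simp add: frame_field_def frame_coord_fun algebra_simps)
    next
      case A12
      show ?thesis
        unfolding A12 by (subst times_det) (simp add: frame_field_def frame_coord_fun algebra_simps)
    next
      case A21
      show ?thesis
        unfolding A21 w by (subst times_det) (simp add: frame_field_def frame_coord_fun algebra_simps)
    next
      case A22
      show ?thesis
        unfolding A22 w by (subst times_det) (simp add: frame_field_def frame_coord_fun algebra_simps)
    qed
  qed
qed

section \<open>The generated Lie algebra\<close>

locale sl2_generated =
  fixes L :: "('k::field_char_0 sl2_ring \<Rightarrow> 'k sl2_ring) set"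
  assumes subalgebra: "lie_subalgebra L"
    and generators: "V12 \<in> L" "vf_mult (coord_fun A21) V21 \<in> L" "vf_mult (coord_fun A22) V21 \<in> L"
begin

lemma frame_field_add:
  assumes "frame_field u v w \<in> L" "frame_field u' v' w' \<in> L"
  shows "frame_field (u + u') (v + v') (w + w') \<in> L"
proof -
  have "(\<lambda>f. frame_field u v w f + frame_field u' v' w' f) \<in> L"
    using subalgebra assms by (auto simp: lie_subalgebra_def)
  then show ?thesis by (simp add: frame_field_def algebra_simps)
qed

lemma frame_field_scaleK:
  assumes "frame_field u v w \<in> L"
  shows "frame_field (scaleK c u) (scaleK c v) (scaleK c w) \<in> L"
proof -
  have "(\<lambda>f. scaleK c (frame_field u v w f)) \<in> L"
    using subalgebra assms by (auto simp: lie_subalgebra_def)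
  then show ?thesis by (simp add: frame_field_def scaleK_simps)
qed

lemma frame_field_of_int_mult:
  assumes "frame_field u v w \<in> L"
  shows "frame_field (of_int k * u) (of_int k * v) (of_int k * w) \<in> L"
  using frame_field_scaleK[OF assms, of "of_int k"] by (simp add: scaleK_of_int)

lemma frame_field_diff:
  assumes "frame_field u v w \<in> L" "frame_field u' v' w' \<in> L"
  shows "frame_field (u - u') (v - v') (w - w') \<in> L"
  using frame_field_add[OF assms(1) frame_field_of_int_mult[OF assms(2), of "- 1"]] by simp

lemma frame_field_bracket:
  assumes "frame_field u v w \<in> L" "frame_field u' v' w' \<in> L"
  shows "frame_field
      (frame_field u v w u' - frame_field u' v' w' u + 2 * (w * u' - u * w'))
      (frame_field u v w v' - frame_field u' v' w' v - 2 * (w * v' - v * w'))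
      (frame_field u v w w' - frame_field u' v' w' w + (u * v' - v * u')) \<in> L"
  using subalgebra assms unfolding vf_bracket_frame_field[symmetric] lie_subalgebra_def by blast

definition mult_E :: "'k sl2_ring set" where "mult_E = {f. frame_field f 0 0 \<in> L}"
definition mult_F :: "'k sl2_ring set" where "mult_F = {f. frame_field 0 f 0 \<in> L}"
definition mult_H :: "'k sl2_ring set" where "mult_H = {f. frame_field 0 0 f \<in> L}"

definition multipliers :: "'k sl2_ring set"
  where "multipliers = mult_E \<inter> mult_F \<inter> mult_H"

lemmas mult_defs = mult_E_def mult_F_def mult_H_def

lemma zero_mult: "0 \<in> mult_E" "0 \<in> mult_F" "0 \<in> mult_H"
  using frame_field_diff[of 1 0 0 1 0 0] generators(1) by (simp_all add: mult_defs frame_field_def)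

lemma mult_diff:
  "f \<in> mult_E \<Longrightarrow> g \<in> mult_E \<Longrightarrow> f - g \<in> mult_E"
  "f \<in> mult_F \<Longrightarrow> g \<in> mult_F \<Longrightarrow> f - g \<in> mult_F"
  "f \<in> mult_H \<Longrightarrow> g \<in> mult_H \<Longrightarrow> f - g \<in> mult_H"
  using frame_field_diff[of f 0 0 g 0 0] frame_field_diff[of 0 f 0 0 g 0]
    frame_field_diff[of 0 0 f 0 0 g]
  by (auto simp: mult_defs)

lemma mult_uminus_iff:
  "- f \<in> mult_E \<longleftrightarrow> f \<in> mult_E" "- f \<in> mult_F \<longleftrightarrow> f \<in> mult_F" "- f \<in> mult_H \<longleftrightarrow> f \<in> mult_H"
  using mult_diff[of 0 f] mult_diff[of 0 "- f"] zero_mult by auto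

lemma mult_scaleK:
  "f \<in> mult_E \<Longrightarrow> scaleK c f \<in> mult_E"
  "f \<in> mult_F \<Longrightarrow> scaleK c f \<in> mult_F"
  "f \<in> mult_H \<Longrightarrow> scaleK c f \<in> mult_H"
  using frame_field_scaleK[of f 0 0 c] frame_field_scaleK[of 0 f 0 c] frame_field_scaleK[of 0 0 f c]
  by (auto simp: mult_defs scaleK_simps)

lemma mult_H_of_int_cancel:
  assumes "of_int k * f \<in> mult_H" "k \<noteq> 0"
  shows "f \<in> mult_H"
  using mult_scaleK(3)[OF assms(1), of "inverse (of_int k)"] assms(2)
  by (simp add: scaleK_inverse_of_int)

text \<open>Mixed brackets have several components; subtracting the known ones isolates the
  last.\<close>

lemma component_in_mult:
  assumes "frame_field u v w \<in> L"
  shows "v \<in> mult_F \<Longrightarrow> w \<in> mult_H \<Longrightarrow> u \<in> mult_E"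
    and "u \<in> mult_E \<Longrightarrow> w \<in> mult_H \<Longrightarrow> v \<in> mult_F"
    and "u \<in> mult_E \<Longrightarrow> v \<in> mult_F \<Longrightarrow> w \<in> mult_H"
  using frame_field_diff[OF frame_field_diff[OF assms, of 0 v 0], of 0 0 w]
    frame_field_diff[OF frame_field_diff[OF assms, of u 0 0], of 0 0 w]
    frame_field_diff[OF frame_field_diff[OF assms, of u 0 0], of 0 v 0]
  by (auto simp: mult_defs)

lemma frame_field_single:
  "frame_field f 0 0 g = f * V12 g" "frame_field 0 f 0 g = f * V21 g" "frame_field 0 0 f g = f * V0 g"
  by (simp_all add: frame_field_def)

text \<open>These specialize the bracket formula to pairs of single-direction fields. Equal
  directions stay in that direction; mixed ones leave components for
  \<open>component_in_mult\<close> to separate.\<close>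

lemma bracket_EE: "f \<in> mult_E \<Longrightarrow> g \<in> mult_E \<Longrightarrow> f * V12 g - g * V12 f \<in> mult_E"
  and bracket_FF: "f \<in> mult_F \<Longrightarrow> g \<in> mult_F \<Longrightarrow> f * V21 g - g * V21 f \<in> mult_F"
  and bracket_HH: "f \<in> mult_H \<Longrightarrow> g \<in> mult_H \<Longrightarrow> f * V0 g - g * V0 f \<in> mult_H"
  and bracket_EF: "f \<in> mult_E \<Longrightarrow> g \<in> mult_F \<Longrightarrow> frame_field (- (g * V21 f)) (f * V12 g) (f * g) \<in> L"
  and bracket_HE: "f \<in> mult_H \<Longrightarrow> g \<in> mult_E \<Longrightarrow>
    frame_field (f * V0 g + 2 * (f * g)) 0 (- (g * V12 f)) \<in> L"
  and bracket_HF: "f \<in> mult_H \<Longrightarrow> g \<in> mult_F \<Longrightarrow>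
    frame_field 0 (f * V0 g - 2 * (f * g)) (- (g * V21 f)) \<in> L"
  using frame_field_bracket[of f 0 0 g 0 0] frame_field_bracket[of 0 f 0 0 g 0]
    frame_field_bracket[of 0 0 f 0 0 g] frame_field_bracket[of f 0 0 0 g 0]
    frame_field_bracket[of 0 0 f g 0 0] frame_field_bracket[of 0 0 f 0 g 0]
  by (simp_all add: mult_defs frame_field_single frame_in_Vec Vec_SL2_0)

lemma one_in_multipliers: "1 \<in> multipliers"
proof -
  have E: "1 \<in> mult_E"
    using generators(1) by (simp add: mult_defs frame_field_def)
  have c: "coord_fun A21 \<in> mult_F" and d: "coord_fun A22 \<in> mult_F"
    using generators(2,3) by (simp_all add: mult_defs frame_field_def vf_mult_def)
  have "coord_fun A21 * coord_fun A12 - coord_fun A22 * coord_fun A11 = (- 1 :: 'k sl2_ring)"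
    using coord_fun_det[where 'a='k] by (simp add: algebra_simps)
  then have F: "1 \<in> mult_F"
    using bracket_FF[OF c d] by (simp add: V21_coord_fun mult_uminus_iff)
  have "1 \<in> mult_H"
    using component_in_mult(3)[OF bracket_EF[OF E F]]
    by (simp add: frame_in_Vec Vec_SL2_1 zero_mult)
  with E F show ?thesis by (simp add: multipliers_def)
qed

lemma multipliers_add: "f \<in> multipliers \<Longrightarrow> g \<in> multipliers \<Longrightarrow> f + g \<in> multipliers"
  using frame_field_add[of f 0 0 g 0 0] frame_field_add[of 0 f 0 0 g 0]
    frame_field_add[of 0 0 f 0 0 g]
  by (simp add: multipliers_def mult_defs)

lemma residue_Const_in_multipliers: "residue (Const c) \<in> multipliers"
  using one_in_multipliers mult_scaleK[of 1 c] by (simp add: multipliers_def scaleK_def)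

text \<open>Bracketing with \<open>E\<close> differentiates the coefficient:
  \<open>[E, fE] = E(f)E\<close>, \<open>[E, fF] = E(f)F + fH\<close>,
  \<open>[fH, E] = 2fE - E(f)H\<close>, where the terms in \<open>f\<close> itself are already in
  \<open>L\<close>.\<close>

lemma V12_in_multipliers:
  assumes "f \<in> multipliers"
  shows "V12 f \<in> multipliers"
proof -
  have f: "f \<in> mult_E" "f \<in> mult_F" "f \<in> mult_H" and 1: "1 \<in> mult_E" "1 \<in> mult_F" "1 \<in> mult_H"
    using assms one_in_multipliers by (simp_all add: multipliers_def)
  have "f * 2 \<in> mult_E"
    using mult_diff(1)[OF f(1), of "- f"] f(1) by (simp add: mult_uminus_iff mult.commute)
  then have "V12 f \<in> mult_H"
    using component_in_mult(3)[OF bracket_HE[OF f(3) 1(1)]]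
    by (simp add: frame_in_Vec Vec_SL2_1 zero_mult mult_uminus_iff mult.commute)
  moreover have "V12 f \<in> mult_E"
    using bracket_EE[OF 1(1) f(1)] by (simp add: frame_in_Vec Vec_SL2_1)
  moreover have "V12 f \<in> mult_F"
    using component_in_mult(2)[OF bracket_EF[OF 1(1) f(2)]] f
    by (simp add: frame_in_Vec Vec_SL2_1 zero_mult)
  ultimately show ?thesis by (simp add: multipliers_def)
qed

text \<open>The mirror argument: bracket with \<open>F\<close> instead of \<open>E\<close>.\<close>

lemma V21_in_multipliers:
  assumes "f \<in> multipliers"
  shows "V21 f \<in> multipliers"
proof -
  have f: "f \<in> mult_E" "f \<in> mult_F" "f \<in> mult_H" and 1: "1 \<in> mult_E" "1 \<in> mult_F" "1 \<in> mult_H"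
    using assms one_in_multipliers by (simp_all add: multipliers_def)
  have "f * 2 \<in> mult_F"
    using mult_diff(2)[OF f(2), of "- f"] f(2) by (simp add: mult_uminus_iff mult.commute)
  then have "V21 f \<in> mult_H"
    using component_in_mult(3)[OF bracket_HF[OF f(3) 1(2)]]
    by (simp add: frame_in_Vec Vec_SL2_1 zero_mult mult_uminus_iff mult.commute)
  moreover have "V21 f \<in> mult_F"
    using bracket_FF[OF 1(2) f(2)] by (simp add: frame_in_Vec Vec_SL2_1)
  moreover have "V21 f \<in> mult_E"
    using component_in_mult(1)[OF bracket_EF[OF f(1) 1(2)]] f
    by (simp add: frame_in_Vec Vec_SL2_1 zero_mult mult_uminus_iff)
  ultimately show ?thesis by (simp add: multipliers_def)
qed

text \<open>As \<open>E\<close> kills \<open>x\<close>, \<open>[E, xF] = xH\<close> and then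
  \<open>[xH, E] = 2xE\<close>. This serves \<open>A21\<close> and \<open>A22\<close>, for which the
  generators supply only the \<open>F\<close> direction.\<close>

lemma highest_weight_in_multipliers:
  assumes x: "x \<in> mult_F" "V12 x = 0" "V0 x = x"
  shows "x \<in> multipliers"
proof -
  have 1: "1 \<in> mult_E"
    using one_in_multipliers by (simp add: multipliers_def)
  have H: "x \<in> mult_H"
    using component_in_mult(3)[OF bracket_EF[OF 1 x(1)]] x
    by (simp add: frame_in_Vec Vec_SL2_1 zero_mult)
  have "2 * x \<in> mult_E"
    using component_in_mult(1)[OF bracket_HE[OF H 1]] x
    by (simp add: frame_in_Vec Vec_SL2_1 zero_mult)
  then have "x \<in> mult_E"
    using mult_scaleK(1)[of "2 * x" "inverse (of_int 2)"] scaleK_inverse_of_int[of 2 x] by simp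
  with H x(1) show ?thesis by (simp add: multipliers_def)
qed

end

text \<open>A basis of the standard representation of \<open>sl\<^sub>2\<close>, highest weight vector first: the columns
  of the matrix, read from bottom to top.\<close>

definition standard_pair :: "'k::field sl2_ring \<Rightarrow> 'k sl2_ring \<Rightarrow> bool"
  where "standard_pair x y \<longleftrightarrow>
    V12 x = 0 \<and> V12 y = x \<and> V21 x = y \<and> V21 y = 0 \<and> V0 x = x \<and> V0 y = - y"

text \<open>Integer weights let the exceptional cases be compared as integers. The zero function has
  every weight.\<close>

definition has_weight :: "int \<Rightarrow> 'k::field sl2_ring \<Rightarrow> bool"
  where "has_weight k f \<longleftrightarrow> V0 f = of_int k * f"

lemma has_weight_V12: "has_weight k f \<Longrightarrow> has_weight (k + 2) (V12 f)"
  by (simp add: has_weight_def V0_V12 frame_in_Vec Vec_SL2_of_int_mult ring_distribs)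

lemma has_weight_V21: "has_weight k f \<Longrightarrow> has_weight (k - 2) (V21 f)"
  by (simp add: has_weight_def V0_V21 frame_in_Vec Vec_SL2_of_int_mult ring_distribs)

lemma sl2_monomial_has_weight: "sl2_monomial f \<Longrightarrow> \<exists>k. has_weight k f"
proof (induction rule: sl2_monomial.induct)
  case (const c)
  have "has_weight 0 (residue (Const c))"
    by (simp add: has_weight_def frame_in_Vec Vec_SL2_Const)
  then show ?case ..
next
  case (coord f i)
  then obtain k where k: "has_weight k f" by blast
  \<comment> \<open>Weights add under products; top-row coordinates have weight -1, bottom-row ones
    1.\<close>
  have "has_weight (k + (if i = A11 \<or> i = A12 then - 1 else 1)) (coord_fun i * f)"
    using k by (cases i)
      (simp_all add: has_weight_def frame_in_Vec Vec_SL2_mult frame_coord_fun algebra_simps)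
  then show ?case ..
qed

section \<open>Products with a standard pair\<close>

context sl2_generated
begin

context
  fixes x y :: "'k sl2_ring"
  assumes pair: "standard_pair x y" and xy: "x \<in> multipliers" "y \<in> multipliers"
begin

lemma pair_simps [simp]:
  "V12 x = 0" "V12 y = x" "V21 x = y" "V21 y = 0" "V0 x = x" "V0 y = - y"
  using pair by (simp_all add: standard_pair_def)

lemma pair_mult [simp]:
  "x \<in> mult_E" "x \<in> mult_F" "x \<in> mult_H" "y \<in> mult_E" "y \<in> mult_F" "y \<in> mult_H"
  using xy by (simp_all add: multipliers_def)

text \<open>\<open>[fH, xH] = (1 - k) fx H\<close> and \<open>[fH, yH] = (-1 - k) fy H\<close>; the
  excluded weights are the zeros of these factors.\<close>

lemma times_pair_in_mult_H_generic:
  assumes "f \<in> multipliers" "has_weight k f"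
  shows "k \<noteq> 1 \<Longrightarrow> f * x \<in> mult_H" and "k \<noteq> - 1 \<Longrightarrow> f * y \<in> mult_H"
proof -
  have f: "f \<in> mult_H" and V0: "V0 f = of_int k * f"
    using assms by (simp_all add: multipliers_def has_weight_def)
  show "f * x \<in> mult_H" if "k \<noteq> 1"
    using bracket_HH[OF f pair_mult(3)] that mult_H_of_int_cancel[of "1 - k" "f * x"]
    by (simp add: V0 algebra_simps)
  show "f * y \<in> mult_H" if "k \<noteq> - 1"
    using bracket_HH[OF f pair_mult(6)] that mult_H_of_int_cancel[of "- 1 - k" "f * y"]
    by (simp add: V0 algebra_simps)
qed

text \<open>In general \<open>[fH, xF] = -fx F - x F(f) H\<close>. Since \<open>F(f)\<close> has
  weight \<open>k - 2\<close>, its product with \<open>x\<close> is covered unless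
  \<open>k = 3\<close>; there \<open>[xH, fF] = fx F - fy H\<close> is used instead.\<close>

lemma times_x_in_mult_F:
  assumes "f \<in> multipliers" "has_weight k f"
  shows "f * x \<in> mult_F"
proof (cases "k = 3")
  case True
  have f: "f \<in> mult_F" and V0: "V0 f = 3 * f"
    using assms True by (simp_all add: multipliers_def has_weight_def)
  have "f * y \<in> mult_H"
    using times_pair_in_mult_H_generic(2)[OF assms] True by simp
  then show ?thesis
    using component_in_mult(2)[OF bracket_HF[OF pair_mult(3) f]]
    by (simp add: V0 zero_mult mult_uminus_iff algebra_simps)
next
  case False
  have f: "f \<in> mult_H" using assms by (simp add: multipliers_def)
  have "V21 f * x \<in> mult_H"
    using times_pair_in_mult_H_generic(1)[OF V21_in_multipliers has_weight_V21] assms False by simp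
  then have "- (f * x) \<in> mult_F"
    using component_in_mult(2)[OF bracket_HF[OF f pair_mult(2)]]
    by (simp add: zero_mult mult_uminus_iff algebra_simps)
  then show ?thesis by (simp add: mult_uminus_iff)
qed

text \<open>Dually, \<open>[fH, yE] = fy E - y E(f) H\<close>, where \<open>E(f)\<close> has weight
  \<open>k + 2\<close>. For \<open>k = -3\<close> the bracket \<open>[yH, fE] = -fy E - fx H\<close>
  takes over.\<close>

lemma times_y_in_mult_E:
  assumes "f \<in> multipliers" "has_weight k f"
  shows "f * y \<in> mult_E"
proof (cases "k = - 3")
  case True
  have f: "f \<in> mult_E" and V0: "V0 f = - 3 * f"
    using assms True by (simp_all add: multipliers_def has_weight_def)
  have "f * x \<in> mult_H"
    using times_pair_in_mult_H_generic(1)[OF assms] True by simp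
  then have "- (f * y) \<in> mult_E"
    using component_in_mult(1)[OF bracket_HE[OF pair_mult(6) f]]
    by (simp add: V0 zero_mult mult_uminus_iff algebra_simps)
  then show ?thesis by (simp add: mult_uminus_iff)
next
  case False
  have f: "f \<in> mult_H" using assms by (simp add: multipliers_def)
  have "V12 f * y \<in> mult_H"
    using times_pair_in_mult_H_generic(2)[OF V12_in_multipliers has_weight_V12] assms False by simp
  then show ?thesis
    using component_in_mult(1)[OF bracket_HE[OF f pair_mult(4)]]
    by (simp add: zero_mult mult_uminus_iff algebra_simps)
qed

lemma times_pair_in_multipliers:
  assumes "f \<in> multipliers" "has_weight k f"
  shows "f * x \<in> multipliers" "f * y \<in> multipliers"
proof -
  have f: "f \<in> mult_E" "f \<in> mult_F" "f \<in> mult_H"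
    using assms by (simp_all add: multipliers_def)
  note Ef = V12_in_multipliers[OF assms(1)] has_weight_V12[OF assms(2)]
  note Ff = V21_in_multipliers[OF assms(1)] has_weight_V21[OF assms(2)]
  \<comment> \<open>\<open>[gE, yE] = (gx - y E(g)) E\<close>, whose last term is covered by
    \<open>times_y_in_mult_E\<close>. A general \<open>g\<close> is needed because the claim is
    applied to both \<open>f\<close> and \<open>V21 f\<close>.\<close>
  have xE: "g * x \<in> mult_E" if "g \<in> multipliers" "has_weight l g" for g l
  proof -
    have g: "g \<in> mult_E" using that by (simp add: multipliers_def)
    have "V12 g * y \<in> mult_E"
      by (rule times_y_in_mult_E[OF V12_in_multipliers has_weight_V12]) fact+
    from mult_diff(1)[OF bracket_EE[OF g pair_mult(4)], of "- (V12 g * y)"] this show ?thesis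
      by (simp add: mult_uminus_iff algebra_simps)
  qed
  \<comment> \<open>Likewise \<open>[gF, xF] = (gy - x F(g)) F\<close>, later applied to
    \<open>f\<close> and to \<open>V12 f\<close>.\<close>
  have yF: "g * y \<in> mult_F" if "g \<in> multipliers" "has_weight l g" for g l
  proof -
    have g: "g \<in> mult_F" using that by (simp add: multipliers_def)
    have "V21 g * x \<in> mult_F"
      by (rule times_x_in_mult_F[OF V21_in_multipliers has_weight_V21]) fact+
    from mult_diff(2)[OF bracket_FF[OF g pair_mult(2)], of "- (V21 g * x)"] this show ?thesis
      by (simp add: mult_uminus_iff algebra_simps)
  qed
  \<comment> \<open>\<open>[fE, xF] = -x F(f) E + fx H\<close> reaches the \<open>H\<close>
    direction with no exceptional weight; below, \<open>[yE, fF] = y E(f) F + fy H\<close> does the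
    same for \<open>y\<close>.\<close>
  have "f * x \<in> mult_H"
    using component_in_mult(3)[OF bracket_EF[OF f(1) pair_mult(2)]] xE[OF Ff]
    by (simp add: mult_uminus_iff zero_mult mult.commute)
  then show "f * x \<in> multipliers"
    using xE[OF assms] times_x_in_mult_F[OF assms] by (simp add: multipliers_def)
  have "f * y \<in> mult_H"
    using component_in_mult(3)[OF bracket_EF[OF pair_mult(4) f(2)]] yF[OF Ef]
    by (simp add: mult_uminus_iff zero_mult mult.commute)
  then show "f * y \<in> multipliers"
    using yF[OF assms] times_y_in_mult_E[OF assms] by (simp add: multipliers_def)
qed

end

lemma times_coord_fun_in_multipliers:
  assumes "f \<in> multipliers" "has_weight k f"
  shows "coord_fun i * f \<in> multipliers"
proof -
  \<comment> \<open>The pairs are the columns of the matrix: the generators give \<open>xF\<close>,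
    the highest weight lemma completes \<open>x\<close>, and \<open>V21\<close> carries it to
    \<open>y\<close>.\<close>
  have column: "x * f \<in> multipliers" "y * f \<in> multipliers"
    if pair: "standard_pair x y" and x: "x \<in> mult_F" for x y
  proof -
    have "x \<in> multipliers"
      using pair x unfolding standard_pair_def by (blast intro: highest_weight_in_multipliers)
    moreover from V21_in_multipliers[OF this] have "y \<in> multipliers"
      using pair unfolding standard_pair_def by metis
    ultimately show "x * f \<in> multipliers" "y * f \<in> multipliers"
      using times_pair_in_multipliers[OF pair _ _ assms] by (simp_all add: mult.commute)
  qed
  have "coord_fun A21 \<in> mult_F" "coord_fun A22 \<in> mult_F"
    using generators(2,3) by (simp_all add: mult_defs frame_field_def vf_mult_def)
  moreover have "standard_pair (coord_fun A21) (coord_fun A11 :: 'k sl2_ring)"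
    "standard_pair (coord_fun A22) (coord_fun A12 :: 'k sl2_ring)"
    by (simp_all add: standard_pair_def frame_coord_fun)
  ultimately show ?thesis
    using column by (cases i) blast+
qed

lemma multipliers_UNIV: "f \<in> multipliers"
\<comment> \<open>Multiplication by a coordinate was shown only for weight functions, so monomials
  are built first and summed afterwards.\<close>
proof (induction f rule: sl2_ring_induct)
  case (monomial f)
  then show ?case
  proof induction
    case (coord f i)
    then show ?case
      using sl2_monomial_has_weight times_coord_fun_in_multipliers by blast
  qed (rule residue_Const_in_multipliers)
qed (rule multipliers_add)

lemma Vec_SL2_subset: "Vec_SL2 \<subseteq> L"
proof
  fix D :: "'k sl2_ring \<Rightarrow> 'k sl2_ring"
  assume "D \<in> Vec_SL2"
  then obtain u v w where D: "D = frame_field u v w" by (rule Vec_SL2_eq_frame_field)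
  have "frame_field (u + 0) (0 + v) (0 + 0) \<in> L"
    using multipliers_UNIV[of u] multipliers_UNIV[of v]
    by (intro frame_field_add) (simp_all add: multipliers_def mult_defs)
  then have "frame_field (u + 0) (v + 0) (0 + w) \<in> L"
    using multipliers_UNIV[of w]
    by (intro frame_field_add) (simp_all add: multipliers_def mult_defs)
  then show "D \<in> L" by (simp add: D)
qed

end

theorem proposition3p6:
  shows "lie_generated
      {V12, vf_mult (coord_fun A21) V21, vf_mult (coord_fun A22) V21} =
    (Vec_SL2 :: ('k::field_char_0 sl2_ring \<Rightarrow> 'k sl2_ring) set)"
    (is "lie_generated ?S = _")
proof
  have "?S \<subseteq> Vec_SL2"
    by (simp add: V12_in_Vec V21_in_Vec vf_mult_in_Vec)
  then have sub: "lie_subalgebra (lie_generated ?S)"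
    by (rule lie_subalgebra_generated)
  then show "lie_generated ?S \<subseteq> Vec_SL2"
    by (simp add: lie_subalgebra_def)
  have "?S \<subseteq> lie_generated ?S"
    unfolding lie_generated_def by (rule hull_subset)
  \<comment> \<open>The locale argument holds for any Lie subalgebra containing the generators; here
    it is applied to the smallest one.\<close>
  then interpret sl2_generated "lie_generated ?S"
    using sub by unfold_locales simp_all
  show "Vec_SL2 \<subseteq> lie_generated ?S" by (rule Vec_SL2_subset)
qed

end
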